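(* Let $K$ be a nonzero commutative ring with $1$ and $G$ a group. Suppose that $g$ is an element of finite order in $G$ and $h$ is an element of $G$ which does not normalize $\langle g\rangle$. The bicyclic unit $u_{g,h}=1+(g-1)h\overline{g}$ of $KG$ is unitary if and only if the characteristic of $K$ is $2$ while $\langle g^2\rangle$ is normalized by $h$ and contains either $h^2$ or $(hg)^2$.
   Context: $KG$ is the group algebra. For $g\in G$ of finite order $|g|$, $\overline{g}=\sum_{i=0}^{|g|-1}g^i\in KG$. The element $u_{g,h}=1+(g-1)h\overline{g}$ is a unit of $KG$ of augmentation $1$, with inverse $1-(g-1)h\overline{g}$. The map $a\mapsto a^*$ is the $K$-linear extension to $KG$ of $g\mapsto g^{-1}$ on $G$; a unit $v$ of augmentation $1$ is unitary if $v^*=v^{-1}$. An element $h$ normalizes a subgroup $S$ if $h^{-1}Sh=S$. The "or" is inclusive. *)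

theory Defs
  imports "HOL-Algebra.Algebra"
begin

text \<open>
  The group algebra \<open>K G\<close>: an element is the family of its coefficients, a function
  \<open>carrier G \<rightarrow> carrier K\<close> of finite support. As in the library, functions are made
  canonical by taking the value \<open>undefined\<close> outside \<open>carrier G\<close>.
\<close>

definition ga_support ::
    "('k, 'm) ring_scheme \<Rightarrow> ('g, 'n) monoid_scheme \<Rightarrow> ('g \<Rightarrow> 'k) \<Rightarrow> 'g set" where
  "ga_support K G a = {x \<in> carrier G. a x \<noteq> \<zero>\<^bsub>K\<^esub>}"

text \<open>\<open>ga_term K G c x\<close> is the element \<open>c x\<close> of \<open>K G\<close>, for \<open>c\<close> in \<open>K\<close> and \<open>x\<close> in \<open>G\<close>.\<close>

definition ga_term ::
    "('k, 'm) ring_scheme \<Rightarrow> ('g, 'n) monoid_scheme \<Rightarrow> 'k \<Rightarrow> 'g \<Rightarrow> 'g \<Rightarrow> 'k" where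
  "ga_term K G c x = (\<lambda>y\<in>carrier G. if y = x then c else \<zero>\<^bsub>K\<^esub>)"

abbreviation ga_of ::
    "('k, 'm) ring_scheme \<Rightarrow> ('g, 'n) monoid_scheme \<Rightarrow> 'g \<Rightarrow> 'g \<Rightarrow> 'k" where
  "ga_of K G x \<equiv> ga_term K G \<one>\<^bsub>K\<^esub> x"

definition group_algebra ::
    "('k, 'm) ring_scheme \<Rightarrow> ('g, 'n) monoid_scheme \<Rightarrow> ('g \<Rightarrow> 'k) ring" where
  "group_algebra K G =
    \<lparr>carrier = {a \<in> carrier G \<rightarrow>\<^sub>E carrier K. finite (ga_support K G a)},
     monoid.mult = (\<lambda>a b. \<lambda>x\<in>carrier G.
       \<Oplus>\<^bsub>K\<^esub>y\<in>ga_support K G a. a y \<otimes>\<^bsub>K\<^esub> b (inv\<^bsub>G\<^esub> y \<otimes>\<^bsub>G\<^esub> x)),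
     monoid.one = ga_of K G \<one>\<^bsub>G\<^esub>,
     ring.zero = (\<lambda>x\<in>carrier G. \<zero>\<^bsub>K\<^esub>),
     ring.add = (\<lambda>a b. \<lambda>x\<in>carrier G. a x \<oplus>\<^bsub>K\<^esub> b x)\<rparr>"

definition augmentation ::
    "('k, 'm) ring_scheme \<Rightarrow> ('g, 'n) monoid_scheme \<Rightarrow> ('g \<Rightarrow> 'k) \<Rightarrow> 'k" where
  "augmentation K G a = (\<Oplus>\<^bsub>K\<^esub>x\<in>ga_support K G a. a x)"

text \<open>The \<open>K\<close>-linear extension to \<open>K G\<close> of the inversion \<open>x \<mapsto> inv x\<close> of \<open>G\<close>.\<close>

definition ga_star ::
    "('k, 'm) ring_scheme \<Rightarrow> ('g, 'n) monoid_scheme \<Rightarrow> ('g \<Rightarrow> 'k) \<Rightarrow> 'g \<Rightarrow> 'k" where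
  "ga_star K G a =
    (\<Oplus>\<^bsub>group_algebra K G\<^esub>x\<in>ga_support K G a. ga_term K G (a x) (inv\<^bsub>G\<^esub> x))"

definition unitary ::
    "('k, 'm) ring_scheme \<Rightarrow> ('g, 'n) monoid_scheme \<Rightarrow> ('g \<Rightarrow> 'k) \<Rightarrow> bool" where
  "unitary K G v \<longleftrightarrow>
    v \<in> Units (group_algebra K G) \<and> augmentation K G v = \<one>\<^bsub>K\<^esub> \<and>
    ga_star K G v = inv\<^bsub>group_algebra K G\<^esub> v"

text \<open>
  The order \<open>group.ord G g\<close> is \<open>0\<close> when \<open>g\<close> has infinite order; the next two definitions are
  only meant for \<open>g\<close> of finite order.
\<close>

definition ga_bar ::
    "('k, 'm) ring_scheme \<Rightarrow> ('g, 'n) monoid_scheme \<Rightarrow> 'g \<Rightarrow> 'g \<Rightarrow> 'k" where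
  "ga_bar K G g =
    (\<Oplus>\<^bsub>group_algebra K G\<^esub>i\<in>{..<group.ord G g}. ga_of K G (g [^]\<^bsub>G\<^esub> (i::nat)))"

definition bicyclic_unit ::
    "('k, 'm) ring_scheme \<Rightarrow> ('g, 'n) monoid_scheme \<Rightarrow> 'g \<Rightarrow> 'g \<Rightarrow> 'g \<Rightarrow> 'k" where
  "bicyclic_unit K G g h =
    \<one>\<^bsub>group_algebra K G\<^esub> \<oplus>\<^bsub>group_algebra K G\<^esub>
    (ga_of K G g \<ominus>\<^bsub>group_algebra K G\<^esub> \<one>\<^bsub>group_algebra K G\<^esub>)
      \<otimes>\<^bsub>group_algebra K G\<^esub> ga_of K G h \<otimes>\<^bsub>group_algebra K G\<^esub> ga_bar K G g"

definition normalizes :: "('g, 'n) monoid_scheme \<Rightarrow> 'g \<Rightarrow> 'g set \<Rightarrow> bool" where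
  "normalizes G h S \<longleftrightarrow> (inv\<^bsub>G\<^esub> h <#\<^bsub>G\<^esub> S) #>\<^bsub>G\<^esub> h = S"

text \<open>
  The characteristic as the order of \<open>1\<close> in the additive group; it is \<open>0\<close> when that order
  is infinite.
\<close>

definition ring_characteristic :: "('k, 'm) ring_scheme \<Rightarrow> nat" where
  "ring_characteristic K = group.ord (add_monoid K) \<one>\<^bsub>K\<^esub>"

end

theory Submission
  imports Defs
begin

text \<open>
  Put \<open>S = \<langle>g\<rangle>\<close>, \<open>A = hS\<close> and \<open>B = ghS\<close>; as \<open>h\<close> does not normalize \<open>S\<close>, the cosets \<open>A\<close> and \<open>B\<close>
  are disjoint. The element \<open>t = (g - 1) h (bar g)\<close> is the difference of the indicator functions of \<open>B\<close>
  and \<open>A\<close>, and \<open>t\<^sup>2 = 0\<close>, so the unit \<open>1 + t\<close> is unitary iff \<open>t\<^sup>* = - t\<close>. Comparing coefficients, this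
  says that \<open>A \<union> B\<close> is closed under inversion and that \<open>1 = -1\<close> in \<open>K\<close> unless inversion exchanges
  \<open>A\<close> and \<open>B\<close>, which it cannot do. What remains is a question about the group: \<open>A \<union> B\<close> is closed under
  inversion iff \<open>h\<close> normalizes \<open>T = \<langle>g\<^sup>2\<rangle>\<close> and, modulo \<open>T\<close>, the inverse of \<open>h\<close> is \<open>h\<close> or \<open>ghg\<close>.
\<close>

subsection \<open>Conjugates of a finite cyclic subgroup\<close>

context group
begin

text \<open>\<open>m_assoc\<close> nests products to the right, so a pair \<open>inv x\<close>,
  \<open>x\<close> no longer forms a subterm of its own; these two rules cancel it inside the nested
  product.\<close>

lemma inv_cancel_left [simp]:
  "x \<in> carrier G \<Longrightarrow> y \<in> carrier G \<Longrightarrow> inv x \<otimes> (x \<otimes> y) = y"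
  "x \<in> carrier G \<Longrightarrow> y \<in> carrier G \<Longrightarrow> x \<otimes> (inv x \<otimes> y) = y"
  by (simp_all flip: m_assoc)

text \<open>Conjugation by \<open>h\<close> is an endomorphism of \<open>G\<close> and so commutes
  with powers.\<close>

lemma int_pow_conj:
  assumes "x \<in> carrier G" "h \<in> carrier G"
  shows "(inv h \<otimes> x \<otimes> h) [^] (k::int) = inv h \<otimes> x [^] k \<otimes> h"
proof -
  have "(\<lambda>y. inv h \<otimes> y \<otimes> h) \<in> hom G G"
    using assms(2) by (auto simp: hom_def m_assoc)
  then interpret c: group_hom G G "\<lambda>y. inv h \<otimes> y \<otimes> h"
    by unfold_locales
  show ?thesis
    using c.hom_int_pow[OF assms(1)] by simp
qed

lemma mem_l_coset_iff:
  assumes "subgroup S G" "x \<in> carrier G" "y \<in> carrier G"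
  shows "y \<in> x <#\<^bsub>G\<^esub> S \<longleftrightarrow> inv x \<otimes> y \<in> S"
proof
  show "inv x \<otimes> y \<in> S" if "y \<in> x <#\<^bsub>G\<^esub> S"
    using that assms by (auto simp: l_coset_def subgroup.mem_carrier)
  show "y \<in> x <#\<^bsub>G\<^esub> S" if "inv x \<otimes> y \<in> S"
    unfolding l_coset_def using that assms by (auto intro!: bexI[of _ "inv x \<otimes> y"])
qed

text \<open>The order of \<open>x\<close> is the cardinality of the subgroup it generates, and
  \<open>card\<close> is 0 on infinite sets.\<close>

lemma finite_generate_singleton:
  assumes "x \<in> carrier G" "ord x \<noteq> 0"
  shows "finite (generate G {x})"
  using generate_pow_card[OF assms(1)] assms(2) by (metis card.infinite)

text \<open>Conjugation sends powers of \<open>x\<close> to powers of the conjugate of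
  \<open>x\<close>, so the condition on the generator puts the whole conjugate subgroup inside the
  original one. Conjugation is injective and the subgroup finite, hence the inclusion is an
  equality.\<close>

lemma normalizes_generate_iff:
  assumes "x \<in> carrier G" "ord x \<noteq> 0" "h \<in> carrier G"
  shows "normalizes G h (generate G {x}) \<longleftrightarrow> inv h \<otimes> x \<otimes> h \<in> generate G {x}"
proof -
  let ?S = "generate G {x}" and ?c = "\<lambda>y. inv h \<otimes> y \<otimes> h"
  have S: "subgroup ?S G"
    using assms by (intro generate_is_subgroup) auto
  have eq: "(inv h <#\<^bsub>G\<^esub> ?S) #> h = ?c ` ?S"
    by (auto simp: l_coset_def r_coset_def)
  have fin: "finite ?S"
    using assms by (intro finite_generate_singleton)
  have inj: "inj_on ?c ?S"
    using subgroup.mem_carrier[OF S] assms by (auto simp: inj_on_def)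
  show ?thesis
  proof
    assume "normalizes G h ?S"
    moreover have "x \<in> ?S" by (simp add: generate.incl)
    ultimately show "?c x \<in> ?S" unfolding normalizes_def eq by blast
  next
    assume x: "?c x \<in> ?S"
    have "?c ` ?S \<subseteq> ?S"
    proof
      fix z assume "z \<in> ?c ` ?S"
      then obtain k :: int where "z = ?c (x [^] k)"
        unfolding generate_pow[OF assms(1)] by blast
      then have "z = ?c x [^] k" using assms by (simp add: int_pow_conj)
      then show "z \<in> ?S"
        using subgroup_int_pow_closed[OF S x] by simp
    qed
    then show "normalizes G h ?S"
      unfolding normalizes_def eq using fin inj by (simp add: card_image card_subset_eq)
  qed
qed

text \<open>Evenness is asked of some exponent, not of every one: for \<open>g\<close> of odd order
  each power of \<open>g\<close> also has an even exponent.\<close>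

lemma pow_mem_generate_square_iff:
  assumes "g \<in> carrier G"
  shows "y \<in> generate G {g [^] (2::nat)} \<longleftrightarrow> (\<exists>k::int. even k \<and> y = g [^] k)"
proof -
  have "(g [^] (2::nat)) [^] k = g [^] (2 * k)" for k :: int
    using int_pow_pow[OF assms, of 2 k] int_pow_int[of G g 2] by simp
  then show ?thesis
    using assms by (auto simp: generate_pow elim!: evenE) (metis even_mult_iff even_numeral)
qed

text \<open>\<open>P\<close> is stable under right multiplication by \<open>S\<close>, so closure
  under inversion is tied to stability under left multiplication by \<open>S\<close>. For the
  converse, normalization of \<open>T\<close> yields left stability, and the condition on the
  squares puts \<open>inv h\<close> into \<open>P\<close>; the inverses of \<open>h s\<close> and
  \<open>g h s\<close> then arise from \<open>inv h\<close> by multiplying with elements of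
  \<open>S\<close> on both sides.\<close>

lemma symmetric_double_coset_iff:
  assumes g: "g \<in> carrier G" and ord: "ord g \<noteq> 0" and h: "h \<in> carrier G"
    and nh: "\<not> normalizes G h (generate G {g})"
  defines "S \<equiv> generate G {g}" and "T \<equiv> generate G {g [^] (2::nat)}"
  defines "P \<equiv> (h <#\<^bsub>G\<^esub> S) \<union> ((g \<otimes> h) <#\<^bsub>G\<^esub> S)"
  shows "(\<forall>y\<in>P. inv y \<in> P) \<longleftrightarrow>
    normalizes G h T \<and> (h [^] (2::nat) \<in> T \<or> (h \<otimes> g) [^] (2::nat) \<in> T)"
proof -
  let ?c = "\<lambda>y. inv h \<otimes> y \<otimes> h"
  have g2: "g [^] (2::nat) = g \<otimes> g" "h [^] (2::nat) = h \<otimes> h" "(h \<otimes> g) [^] (2::nat) = h \<otimes> (g \<otimes> (h \<otimes> g))"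
    using g h by (simp_all add: numeral_2_eq_2 m_assoc)
  have S: "subgroup S G" and T: "subgroup T G"
    unfolding S_def T_def using g by (auto intro!: generate_is_subgroup)
  note [simp] = subgroup.mem_carrier[OF S] subgroup.mem_carrier[OF T]
  have S_pow: "y \<in> S \<longleftrightarrow> (\<exists>k::int. y = g [^] k)" for y
    unfolding S_def using g by (simp add: generate_pow)
  have T_pow: "y \<in> T \<longleftrightarrow> (\<exists>k::int. even k \<and> y = g [^] k)" for y
    unfolding T_def using pow_mem_generate_square_iff[OF g] .
  have TS: "T \<subseteq> S" by (auto simp: S_pow T_pow)
  have gS: "g \<in> S" unfolding S_def by (simp add: generate.incl)
  have ggT: "g \<otimes> g \<in> T" unfolding T_def g2 by (simp add: generate.incl)
  \<comment> \<open>\<open>T\<close> has index at most 2 in \<open>S\<close>: the parity of an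
    exponent selects the coset \<open>T\<close> or \<open>g T\<close>. Both alternatives hold when
    the order of \<open>g\<close> is odd.\<close>
  have split: "s \<in> T \<or> inv g \<otimes> s \<in> T" if s: "s \<in> S" for s
  proof -
    obtain k :: int where k: "s = g [^] k" using s S_pow by blast
    have "inv g \<otimes> s = g [^] (k - 1)"
      using g int_pow_mult[OF g, of "-1" "k"] by (simp add: k int_pow_neg)
    moreover have "even k \<or> even (k - 1)" by simp
    ultimately show ?thesis using k T_pow by metis
  qed
  note Sm = subgroup.m_closed[OF S] and Si = subgroup.m_inv_closed[OF S]
    and Tm = subgroup.m_closed[OF T] and Ti = subgroup.m_inv_closed[OF T]
  have ncg: "?c g \<notin> S"
    using nh normalizes_generate_iff[OF g ord h] unfolding S_def by simp
  have mc1: "y \<in> h <#\<^bsub>G\<^esub> S \<longleftrightarrow> inv h \<otimes> y \<in> S" if "y \<in> carrier G" for y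
    using mem_l_coset_iff[OF S h that] .
  have mc2: "y \<in> (g \<otimes> h) <#\<^bsub>G\<^esub> S \<longleftrightarrow> inv h \<otimes> (inv g \<otimes> y) \<in> S" if "y \<in> carrier G" for y
    using mem_l_coset_iff[OF S _ that, of "g \<otimes> h"] g h that by (simp add: inv_mult_group m_assoc)
  have P: "y \<in> P \<longleftrightarrow> inv h \<otimes> y \<in> S \<or> inv h \<otimes> (inv g \<otimes> y) \<in> S" if "y \<in> carrier G" for y
    unfolding P_def using that mc1 mc2 by blast
  have Pc: "P \<subseteq> carrier G"
    unfolding P_def l_coset_def using g h by auto
  have Pr: "y \<otimes> s \<in> P" if "y \<in> P" "s \<in> S" for y s
  proof -
    have y: "y \<in> carrier G" using that Pc by blast
    show ?thesis
      using that Sm[of "inv h \<otimes> y" s] Sm[of "inv h \<otimes> (inv g \<otimes> y)" s] g h y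
      by (auto simp: P m_assoc)
  qed
  have cT: "?c t \<in> T" if "normalizes G h T" "t \<in> T" for t
    using that unfolding normalizes_def l_coset_def r_coset_def by blast
  \<comment> \<open>Otherwise \<open>h^2 = g t\<close> with \<open>t\<close> in \<open>T\<close>.
    Since \<open>h\<close> commutes with \<open>h^2\<close>, conjugating by \<open>h\<close> gives
    \<open>h^2 = ?c g ?c t\<close>, which would force \<open>?c g\<close> into
    \<open>S\<close>.\<close>
  have sq: "h \<otimes> h \<in> T" if N: "normalizes G h T" and "h \<otimes> h \<in> S"
  proof (rule ccontr)
    assume "h \<otimes> h \<notin> T"
    then have t: "inv g \<otimes> (h \<otimes> h) \<in> T" using split that by blast
    have "?c g = ?c (h \<otimes> h) \<otimes> inv (?c (inv g \<otimes> (h \<otimes> h)))"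
      using g h by (simp add: m_assoc inv_mult_group)
    also have "?c (h \<otimes> h) = h \<otimes> h" using h by (simp add: m_assoc)
    finally show False
      using ncg Sm Si that cT[OF N t] TS by (metis subsetD)
  qed
  \<comment> \<open>As \<open>P\<close> is a union of left cosets of \<open>S\<close>, symmetry makes it stable under left
    multiplication by \<open>g\<close>, which must then swap the two cosets: \<open>g\<^sup>2\<close> is conjugated into \<open>S\<close> by \<open>h\<close>,
    and counting orders, into \<open>T\<close>.\<close>
  show ?thesis
  proof
    assume sym: "\<forall>y\<in>P. inv y \<in> P"
    have hP: "h \<in> P" using P[OF h] h subgroup.one_closed[OF S] by simp
    then have hiP: "inv h \<in> P" using sym by blast
    \<comment> \<open>Inverting \<open>h\<close>, multiplying by \<open>g^-2\<close> on the right
      and inverting again amounts to multiplying \<open>h\<close> by \<open>g^2\<close> on the left.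
      If \<open>g^2 h\<close> lay in \<open>g h S\<close>, then \<open>?c g\<close> would be in
      \<open>S\<close>; so it lies in \<open>h S\<close>.\<close>
    then have "inv h \<otimes> inv (g \<otimes> g) \<in> P" using ggT TS Si by (intro Pr) auto
    then have "inv (inv h \<otimes> inv (g \<otimes> g)) \<in> P" using sym by blast
    then have "g \<otimes> (g \<otimes> h) \<in> P" using g h by (simp add: inv_mult_group m_assoc)
    then have "?c (g \<otimes> g) \<in> S \<or> ?c g \<in> S"
      using P[of "g \<otimes> (g \<otimes> h)"] g h by (simp add: m_assoc)
    then have c2S: "?c (g \<otimes> g) \<in> S" using ncg by blast
    have c2pow: "?c (g \<otimes> g) [^] k = ?c (g [^] (2 * k))" for k :: int
      using g h int_pow_pow[OF g, of 2 k] int_pow_int[of G g 2] g2(1) by (simp add: int_pow_conj)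
    \<comment> \<open>If the order were \<open>2 m + 1\<close>, then \<open>g\<close> would be the
      power \<open>m + 1\<close> of \<open>g^2\<close>, and \<open>?c g\<close> a power of
      \<open>?c (g^2)\<close>, hence in \<open>S\<close>.\<close>
    have ev: "even (ord g)"
    proof (rule ccontr)
      assume "odd (ord g)"
      then obtain m where m: "ord g = 2 * m + 1" by (elim oddE)
      have "g [^] (2 * (int m + 1)) = g [^] int (ord g) \<otimes> g"
        using int_pow_mult[OF g, of "int (ord g)" 1] g by (simp add: m algebra_simps)
      then have "g [^] (2 * (int m + 1)) = g"
        using g by (simp add: int_pow_int)
      then show False
        using c2pow[of "int m + 1"] subgroup_int_pow_closed[OF S c2S, of "int m + 1"] ncg by simp
    qed
    then obtain m where m: "ord g = 2 * m" by (elim evenE)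
    obtain k :: int where k: "?c (g \<otimes> g) = g [^] k" using c2S unfolding S_pow by blast
    \<comment> \<open>Raising \<open>?c (g^2) = g^k\<close> to the power \<open>m\<close> gives the
      identity, as \<open>2 m\<close> is the order of \<open>g\<close>. So \<open>2 m\<close>
      divides \<open>k m\<close>; the order is nonzero, hence \<open>m\<close> cancels and
      \<open>k\<close> is even.\<close>
    have "g [^] (k * int m) = ?c (g [^] (2 * int m))"
      using c2pow[of "int m"] int_pow_pow[OF g] k by simp
    also have "g [^] (2 * int m) = \<one>" using g m by (simp add: int_pow_eq_id)
    finally have "g [^] (k * int m) = \<one>" using h by simp
    then have "int (2 * m) dvd k * int m" using g m by (simp add: int_pow_eq_id)
    then have "even k" using ord m by simp
    then have "?c (g \<otimes> g) \<in> T" unfolding T_pow k by blast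
    moreover have "ord (g [^] (2::nat)) \<noteq> 0"
      using g ord by (metis pow_eq_id pow_ord_eq_1 nat_pow_pow nat_pow_closed mult.commute dvd_0_left_iff nat_pow_one)
    ultimately have N: "normalizes G h T"
      using normalizes_generate_iff[of "g [^] (2::nat)" h] g h unfolding T_def g2 by simp
    moreover have "h \<otimes> h \<in> T \<or> h \<otimes> (g \<otimes> (h \<otimes> g)) \<in> T"
    proof -
      from hiP consider "inv h \<otimes> inv h \<in> S" | "inv h \<otimes> (inv g \<otimes> inv h) \<in> S"
        using P h by auto
      then show ?thesis
      proof cases
        case 1
        then have "h \<otimes> h \<in> S" using Si[of "inv h \<otimes> inv h"] h by (simp add: inv_mult_group)
        then show ?thesis using sq[OF N] by blast
      next
        case 2
        then have "h \<otimes> (g \<otimes> h) \<in> S"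
          using Si[of "inv h \<otimes> (inv g \<otimes> inv h)"] g h by (simp add: inv_mult_group m_assoc)
        then have "h \<otimes> (g \<otimes> h) \<in> T \<or> inv g \<otimes> (h \<otimes> (g \<otimes> h)) \<in> T" using split by blast
        then show ?thesis
        proof
          assume "h \<otimes> (g \<otimes> h) \<in> T"
          \<comment> \<open>Conjugating \<open>h g h\<close> by \<open>h\<close> gives
            \<open>g h^2\<close>, which reduces this case to \<open>sq\<close>.\<close>
          from cT[OF N this] have "g \<otimes> (h \<otimes> h) \<in> S" using g h TS by (auto simp: m_assoc)
          from Sm[OF Si[OF gS] this] have "h \<otimes> h \<in> S" using g h by simp
          then show ?thesis using sq[OF N] by blast
        next
          assume t: "inv g \<otimes> (h \<otimes> (g \<otimes> h)) \<in> T"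
          obtain j :: int where j: "even j" "inv g \<otimes> (h \<otimes> (g \<otimes> h)) = g [^] j"
            using t unfolding T_pow by blast
          \<comment> \<open>Here \<open>h g h\<close> is an odd power of \<open>g\<close>, written
            \<open>g^(1 + j)\<close>; one more factor \<open>g\<close> makes the exponent
            even.\<close>
          have "h \<otimes> (g \<otimes> h) = g \<otimes> g [^] j" using g h j(2)[symmetric] by simp
          then have "h \<otimes> (g \<otimes> (h \<otimes> g)) = g \<otimes> g [^] j \<otimes> g"
            using g h by (metis m_assoc m_closed)
          also have "\<dots> = g [^] (1 + j + 1)" using g by (simp only: int_pow_mult) simp
          finally have "h \<otimes> (g \<otimes> (h \<otimes> g)) \<in> T"
            using j(1) unfolding T_pow by (intro exI[of _ "1 + j + 1"]) simp
          then show ?thesis ..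
        qed
      qed
    qed
    ultimately show "normalizes G h T \<and> (h [^] (2::nat) \<in> T \<or> (h \<otimes> g) [^] (2::nat) \<in> T)"
      unfolding g2 by blast
  next
    assume "normalizes G h T \<and> (h [^] (2::nat) \<in> T \<or> (h \<otimes> g) [^] (2::nat) \<in> T)"
    then have N: "normalizes G h T" and sq: "h \<otimes> h \<in> T \<or> h \<otimes> (g \<otimes> (h \<otimes> g)) \<in> T"
      unfolding g2 by auto
    \<comment> \<open>Left multiplication by \<open>inv g\<close> exchanges the two cosets:
      \<open>g h s\<close> goes to \<open>h s\<close>, and \<open>h s\<close> goes into
      \<open>g h S\<close> because \<open>g^-2\<close> is conjugated into \<open>S\<close> by
      \<open>h\<close>.\<close>
    have gP: "inv g \<otimes> y \<in> P" if "y \<in> P" for y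
    proof -
      have y: "y \<in> carrier G" using that Pc by blast
      consider "inv h \<otimes> y \<in> S" | "inv h \<otimes> (inv g \<otimes> y) \<in> S" using P[OF y] \<open>y \<in> P\<close> by blast
      then show ?thesis
      proof cases
        case 1
        have "?c (inv (g \<otimes> g)) \<in> S" using cT[OF N Ti[OF ggT]] TS by blast
        from Sm[OF this 1] have "inv h \<otimes> (inv g \<otimes> (inv g \<otimes> y)) \<in> S"
          using g h y by (simp add: m_assoc inv_mult_group)
        then show ?thesis using P g y by simp
      qed (use P g y in simp)
    qed
    have invh: "inv h \<in> P"
      using sq
    proof
      assume "h \<otimes> h \<in> T"
      then have "inv (h \<otimes> h) \<in> S" using Ti TS by blast
      then show ?thesis using P h by (simp add: inv_mult_group)
    next
      assume "h \<otimes> (g \<otimes> (h \<otimes> g)) \<in> T"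
      \<comment> \<open>The factor \<open>g\<close> cancels the leading \<open>inv g\<close> of the
        inverse and leaves \<open>h^-1 g^-1 h^-1\<close>; its membership in \<open>S\<close> says
        that \<open>inv h\<close> lies in \<open>g h S\<close>.\<close>
      then have "g \<otimes> inv (h \<otimes> (g \<otimes> (h \<otimes> g))) \<in> S" using Ti TS gS Sm by blast
      then show ?thesis using P g h by (simp add: inv_mult_group m_assoc)
    qed
    have left: "s \<otimes> y \<in> P" if s: "s \<in> S" and y: "y \<in> P" for s y
    proof -
      \<comment> \<open>As \<open>g\<close> has finite order, \<open>inv s\<close> is a power with
        natural exponent, so \<open>s\<close> is a product of factors \<open>inv g\<close> and
        \<open>gP\<close> can be iterated.\<close>
      have "inv s \<in> S" using s Si by blast
      then obtain k :: nat where k: "inv s = g [^] k"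
        using generate_pow_nat[OF g ord] unfolding S_def by blast
      have "inv (g [^] k) \<otimes> y \<in> P" for k :: nat
      proof (induction k)
        case (Suc k)
        have "inv (g [^] Suc k) \<otimes> y = inv g \<otimes> (inv (g [^] k) \<otimes> y)"
          using g y Pc by (auto simp: inv_mult_group m_assoc)
        then show ?case using gP[OF Suc] by simp
      qed (use y Pc in auto)
      from this[of k] show ?thesis using s by (simp flip: k)
    qed
    show "\<forall>y\<in>P. inv y \<in> P"
    proof
      fix y assume "y \<in> P"
      then have y: "y \<in> carrier G" using Pc by blast
      consider "inv h \<otimes> y \<in> S" | "inv h \<otimes> (inv g \<otimes> y) \<in> S" using P[OF y] \<open>y \<in> P\<close> by blast
      then show "inv y \<in> P"
      proof cases
        case 1
        from left[OF Si[OF 1] invh] show ?thesis using h y by (simp add: inv_mult_group m_assoc)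
      next
        case 2
        from Pr[OF left[OF Si[OF 2] invh] Si[OF gS]] show ?thesis
          using g h y by (simp add: inv_mult_group m_assoc)
      qed
    qed
  qed
qed

end

subsection \<open>The group algebra as a ring\<close>

context abelian_monoid
begin

lemma finsum_swap:
  assumes "finite A" "finite B" "\<And>x y. x \<in> A \<Longrightarrow> y \<in> B \<Longrightarrow> f x y \<in> carrier G"
  shows "(\<Oplus>x\<in>A. \<Oplus>y\<in>B. f x y) = (\<Oplus>y\<in>B. \<Oplus>x\<in>A. f x y)"
  using assms(1,3)
proof (induction A rule: finite_induct)
  case empty
  then show ?case by (simp add: finsum_zero)
next
  case (insert a A)
  have "(\<Oplus>x\<in>insert a A. \<Oplus>y\<in>B. f x y) = (\<Oplus>y\<in>B. f a y) \<oplus> (\<Oplus>x\<in>A. \<Oplus>y\<in>B. f x y)"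
    using insert by (intro finsum_insert) (auto intro!: finsum_closed)
  also have "\<dots> = (\<Oplus>y\<in>B. f a y) \<oplus> (\<Oplus>y\<in>B. \<Oplus>x\<in>A. f x y)"
    using insert by simp
  also have "\<dots> = (\<Oplus>y\<in>B. f a y \<oplus> (\<Oplus>x\<in>A. f x y))"
    using insert by (intro finsum_addf [symmetric]) (auto intro!: finsum_closed)
  also have "\<dots> = (\<Oplus>y\<in>B. \<Oplus>x\<in>insert a A. f x y)"
    using insert by (intro finsum_cong' finsum_insert [symmetric]) (auto intro!: finsum_closed)
  finally show ?case .
qed

end

section \<open>Coefficients, supports and closure in the group algebra\<close>

locale group_ring = K?: ring K + G: group G
  for K (structure) and G (structure)
begin

abbreviation KG where "KG \<equiv> group_algebra K G"
abbreviation supp where "supp \<equiv> ga_support K G"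

lemma mem_carrier_KG_iff:
  "a \<in> carrier KG \<longleftrightarrow> a \<in> carrier G \<rightarrow>\<^sub>E carrier K \<and> finite (supp a)"
  by (simp add: group_algebra_def)

lemma KG_apply_closed [simp]:
  "a \<in> carrier KG \<Longrightarrow> x \<in> carrier G \<Longrightarrow> a x \<in> carrier K"
  unfolding mem_carrier_KG_iff by (blast dest: PiE_mem)

lemma finite_supp [simp]: "a \<in> carrier KG \<Longrightarrow> finite (supp a)"
  by (simp add: mem_carrier_KG_iff)

lemma supp_subset: "supp a \<subseteq> carrier G"
  by (auto simp: ga_support_def)

lemma not_supp: "x \<in> carrier G \<Longrightarrow> x \<notin> supp a \<Longrightarrow> a x = \<zero>\<^bsub>K\<^esub>"
  by (simp add: ga_support_def)

text \<open>Any finite set outside which \<open>f\<close> vanishes will do, so the exact support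
  need not be computed.\<close>

lemma KG_memI:
  assumes "finite F" "\<And>x. x \<in> carrier G \<Longrightarrow> f x \<in> carrier K"
    "\<And>x. x \<in> carrier G \<Longrightarrow> x \<notin> F \<Longrightarrow> f x = \<zero>\<^bsub>K\<^esub>"
  shows "restrict f (carrier G) \<in> carrier KG"
proof -
  have "supp (restrict f (carrier G)) \<subseteq> F"
    using assms(3) by (auto simp: ga_support_def)
  then show ?thesis
    using assms(1,2) by (auto simp: mem_carrier_KG_iff intro: finite_subset)
qed

lemma KG_eqI:
  assumes "a \<in> carrier KG" "b \<in> carrier KG" "\<And>x. x \<in> carrier G \<Longrightarrow> a x = b x"
  shows "a = b"
  using assms by (auto simp: mem_carrier_KG_iff intro: PiE_ext)

lemma zero_KG: "\<zero>\<^bsub>KG\<^esub> = (\<lambda>x\<in>carrier G. \<zero>\<^bsub>K\<^esub>)"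
  and one_KG: "\<one>\<^bsub>KG\<^esub> = ga_of K G \<one>\<^bsub>G\<^esub>"
  and add_KG: "a \<oplus>\<^bsub>KG\<^esub> b = (\<lambda>x\<in>carrier G. a x \<oplus>\<^bsub>K\<^esub> b x)"
  and mult_KG: "a \<otimes>\<^bsub>KG\<^esub> b = (\<lambda>x\<in>carrier G. \<Oplus>\<^bsub>K\<^esub>y\<in>supp a. a y \<otimes>\<^bsub>K\<^esub> b (inv\<^bsub>G\<^esub> y \<otimes>\<^bsub>G\<^esub> x))"
  by (simp_all only: group_algebra_def monoid.simps ring.simps)

lemma zero_apply [simp]: "x \<in> carrier G \<Longrightarrow> \<zero>\<^bsub>KG\<^esub> x = \<zero>\<^bsub>K\<^esub>"
  and add_apply [simp]: "x \<in> carrier G \<Longrightarrow> (a \<oplus>\<^bsub>KG\<^esub> b) x = a x \<oplus>\<^bsub>K\<^esub> b x"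
  by (simp_all add: zero_KG add_KG)

lemma ga_term_apply:
  "y \<in> carrier G \<Longrightarrow> ga_term K G c x y = (if y = x then c else \<zero>\<^bsub>K\<^esub>)"
  by (simp add: ga_term_def)

text \<open>The terms outside \<open>supp a\<close> vanish. Freedom in the index set lets products
  with different left factors be summed over one common set; the support of a sum can be smaller
  than the union of the supports.\<close>

lemma mult_apply:
  assumes "finite F" "supp a \<subseteq> F" "F \<subseteq> carrier G"
    "a \<in> carrier KG" "b \<in> carrier KG" "x \<in> carrier G"
  shows "(a \<otimes>\<^bsub>KG\<^esub> b) x = (\<Oplus>\<^bsub>K\<^esub>y\<in>F. a y \<otimes>\<^bsub>K\<^esub> b (inv\<^bsub>G\<^esub> y \<otimes>\<^bsub>G\<^esub> x))"
proof -
  have "(\<Oplus>\<^bsub>K\<^esub>y\<in>supp a. a y \<otimes>\<^bsub>K\<^esub> b (inv\<^bsub>G\<^esub> y \<otimes>\<^bsub>G\<^esub> x)) = (\<Oplus>\<^bsub>K\<^esub>y\<in>F. a y \<otimes>\<^bsub>K\<^esub> b (inv\<^bsub>G\<^esub> y \<otimes>\<^bsub>G\<^esub> x))"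
    by (rule add.finprod_mono_neutral_cong_left) (use assms in \<open>auto simp: not_supp subset_iff\<close>)
  then show ?thesis
    using assms(6) by (simp only: mult_KG restrict_apply' if_True)
qed

lemma mult_apply_supp:
  assumes "a \<in> carrier KG" "b \<in> carrier KG" "x \<in> carrier G"
  shows "(a \<otimes>\<^bsub>KG\<^esub> b) x = (\<Oplus>\<^bsub>K\<^esub>y\<in>supp a. a y \<otimes>\<^bsub>K\<^esub> b (inv\<^bsub>G\<^esub> y \<otimes>\<^bsub>G\<^esub> x))"
  using assms by (intro mult_apply supp_subset) auto

lemma zero_closed_KG: "\<zero>\<^bsub>KG\<^esub> \<in> carrier KG"
  using KG_memI[of "{}" "\<lambda>_. \<zero>\<^bsub>K\<^esub>"] by (simp add: zero_KG)

lemma ga_term_closed [simp]: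
  assumes "c \<in> carrier K" shows "ga_term K G c x \<in> carrier KG"
  unfolding ga_term_def using assms by (intro KG_memI[of "{x}"]) auto

lemma one_closed_KG: "\<one>\<^bsub>KG\<^esub> \<in> carrier KG"
  using ga_term_closed[of "\<one>\<^bsub>K\<^esub>" "\<one>\<^bsub>G\<^esub>"] by (simp add: one_KG)

lemma add_closed_KG:
  assumes "a \<in> carrier KG" "b \<in> carrier KG" shows "a \<oplus>\<^bsub>KG\<^esub> b \<in> carrier KG"
proof -
  have "restrict (\<lambda>x. a x \<oplus>\<^bsub>K\<^esub> b x) (carrier G) \<in> carrier KG"
    using assms by (intro KG_memI[of "supp a \<union> supp b"]) (auto simp: not_supp)
  then show ?thesis by (simp add: add_KG)
qed

text \<open>If \<open>x\<close> has no factorization through the two supports, every term of its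
  coefficient vanishes. The product of the supports is finite, which bounds the support of the
  product.\<close>

lemma supp_mult:
  assumes "a \<in> carrier KG" "b \<in> carrier KG"
  shows "supp (a \<otimes>\<^bsub>KG\<^esub> b) \<subseteq> supp a <#>\<^bsub>G\<^esub> supp b"
proof
  fix x assume "x \<in> supp (a \<otimes>\<^bsub>KG\<^esub> b)"
  then have x: "x \<in> carrier G" and nz: "(a \<otimes>\<^bsub>KG\<^esub> b) x \<noteq> \<zero>\<^bsub>K\<^esub>"
    by (auto simp: ga_support_def)
  have "\<exists>y\<in>supp a. inv\<^bsub>G\<^esub> y \<otimes>\<^bsub>G\<^esub> x \<in> supp b"
  proof (rule ccontr)
    assume "\<not> ?thesis"
    then have "a y \<otimes>\<^bsub>K\<^esub> b (inv\<^bsub>G\<^esub> y \<otimes>\<^bsub>G\<^esub> x) = \<zero>\<^bsub>K\<^esub>" if "y \<in> supp a" for y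
      using that assms x supp_subset[of a] by (auto simp: not_supp subset_iff)
    then show False
      using nz mult_apply_supp[OF assms x] by (simp add: add.finprod_one_eqI)
  qed
  then obtain y where y: "y \<in> supp a" "inv\<^bsub>G\<^esub> y \<otimes>\<^bsub>G\<^esub> x \<in> supp b" by blast
  moreover have "x = y \<otimes>\<^bsub>G\<^esub> (inv\<^bsub>G\<^esub> y \<otimes>\<^bsub>G\<^esub> x)"
    using y x supp_subset[of a] by (auto simp flip: G.m_assoc)
  ultimately show "x \<in> supp a <#>\<^bsub>G\<^esub> supp b"
    unfolding set_mult_def by blast
qed

lemma finite_set_mult:
  "finite A \<Longrightarrow> finite B \<Longrightarrow> finite (A <#>\<^bsub>G\<^esub> B)"
  by (simp add: set_mult_def)

lemma mult_closed_KG: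
  assumes "a \<in> carrier KG" "b \<in> carrier KG" shows "a \<otimes>\<^bsub>KG\<^esub> b \<in> carrier KG"
proof -
  have "(a \<otimes>\<^bsub>KG\<^esub> b) x \<in> carrier K" if "x \<in> carrier G" for x
    unfolding mult_apply_supp[OF assms that]
    using assms that supp_subset[of a] by (auto intro!: finsum_closed simp: subset_iff)
  moreover have "a \<otimes>\<^bsub>KG\<^esub> b \<in> extensional (carrier G)"
    by (simp only: mult_KG restrict_extensional)
  moreover have "finite (supp (a \<otimes>\<^bsub>KG\<^esub> b))"
    using finite_subset[OF supp_mult[OF assms] finite_set_mult] assms by simp
  ultimately show ?thesis
    unfolding mem_carrier_KG_iff PiE_def by blast
qed

text \<open>Both sides expand to one double sum over \<open>z\<close> in \<open>supp a\<close> and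
  over the middle variable \<open>y\<close>; \<open>?F\<close> contains the support of the product
  of \<open>a\<close> and \<open>b\<close>, so \<open>y\<close> may range over it independently of
  \<open>z\<close>, and the sums can be exchanged.\<close>

lemma mult_assoc_KG:
  assumes a: "a \<in> carrier KG" and b: "b \<in> carrier KG" and c: "c \<in> carrier KG"
  shows "(a \<otimes>\<^bsub>KG\<^esub> b) \<otimes>\<^bsub>KG\<^esub> c = a \<otimes>\<^bsub>KG\<^esub> (b \<otimes>\<^bsub>KG\<^esub> c)"
proof (rule KG_eqI)
  fix x assume x: "x \<in> carrier G"
  let ?F = "supp a <#>\<^bsub>G\<^esub> supp b"
  have F: "finite ?F" "?F \<subseteq> carrier G"
    using a b supp_subset G.set_mult_closed by (auto intro!: finite_set_mult)
  have sa: "y \<in> carrier G" if "y \<in> supp a" for a y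
    using that supp_subset by blast
  \<comment> \<open>For fixed \<open>z\<close> only the translate of \<open>supp b\<close> by
    \<open>z\<close> contributes, and the substitution of \<open>z w\<close> for \<open>y\<close>
    turns the sum into a coefficient of the product of \<open>b\<close> and
    \<open>c\<close>.\<close>
  have inner: "(\<Oplus>\<^bsub>K\<^esub>y\<in>?F. b (inv\<^bsub>G\<^esub> z \<otimes>\<^bsub>G\<^esub> y) \<otimes>\<^bsub>K\<^esub> c (inv\<^bsub>G\<^esub> y \<otimes>\<^bsub>G\<^esub> x)) = (b \<otimes>\<^bsub>KG\<^esub> c) (inv\<^bsub>G\<^esub> z \<otimes>\<^bsub>G\<^esub> x)"
    if z: "z \<in> supp a" for z
  proof -
    let ?f = "\<lambda>y. b (inv\<^bsub>G\<^esub> z \<otimes>\<^bsub>G\<^esub> y) \<otimes>\<^bsub>K\<^esub> c (inv\<^bsub>G\<^esub> y \<otimes>\<^bsub>G\<^esub> x)" and ?zb = "(\<otimes>\<^bsub>G\<^esub>) z ` supp b"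
    have zc: "z \<in> carrier G" using z sa by blast
    have "(\<Oplus>\<^bsub>K\<^esub>y\<in>?zb. ?f y) = (\<Oplus>\<^bsub>K\<^esub>y\<in>?F. ?f y)"
    proof (rule add.finprod_mono_neutral_cong_left)
      show "finite ?F" by fact
      show "?zb \<subseteq> ?F" using z by (auto simp: set_mult_def)
      show "?f \<in> ?F \<rightarrow> carrier K" using b c zc x F by (auto simp: subset_iff)
      fix y assume y: "y \<in> ?F - ?zb"
      then have yc: "y \<in> carrier G" using F by blast
      have "inv\<^bsub>G\<^esub> z \<otimes>\<^bsub>G\<^esub> y \<notin> supp b"
      proof
        assume "inv\<^bsub>G\<^esub> z \<otimes>\<^bsub>G\<^esub> y \<in> supp b"
        moreover have "y = z \<otimes>\<^bsub>G\<^esub> (inv\<^bsub>G\<^esub> z \<otimes>\<^bsub>G\<^esub> y)" using zc yc by (simp flip: G.m_assoc)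
        ultimately show False using y by blast
      qed
      then show "?f y = \<zero>\<^bsub>K\<^esub>" using c zc yc x by (simp add: not_supp)
    qed simp
    moreover have "(\<Oplus>\<^bsub>K\<^esub>y\<in>?zb. ?f y) = (\<Oplus>\<^bsub>K\<^esub>w\<in>supp b. ?f (z \<otimes>\<^bsub>G\<^esub> w))"
      using zc b c x sa by (intro add.finprod_reindex) (auto simp: inj_on_def)
    moreover have "\<dots> = (\<Oplus>\<^bsub>K\<^esub>w\<in>supp b. b w \<otimes>\<^bsub>K\<^esub> c (inv\<^bsub>G\<^esub> w \<otimes>\<^bsub>G\<^esub> (inv\<^bsub>G\<^esub> z \<otimes>\<^bsub>G\<^esub> x)))"
    proof (rule finsum_cong')
      fix w assume "w \<in> supp b"
      then have w: "w \<in> carrier G" using sa by blast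
      have "inv\<^bsub>G\<^esub> z \<otimes>\<^bsub>G\<^esub> (z \<otimes>\<^bsub>G\<^esub> w) = w"
        using w zc by (simp flip: G.m_assoc)
      then show "?f (z \<otimes>\<^bsub>G\<^esub> w) = b w \<otimes>\<^bsub>K\<^esub> c (inv\<^bsub>G\<^esub> w \<otimes>\<^bsub>G\<^esub> (inv\<^bsub>G\<^esub> z \<otimes>\<^bsub>G\<^esub> x))"
        using w zc x by (simp add: G.inv_mult_group G.m_assoc)
    qed (use b c zc x sa in auto)
    ultimately show ?thesis
      using mult_apply_supp[OF b c, of "inv\<^bsub>G\<^esub> z \<otimes>\<^bsub>G\<^esub> x"] zc x by simp
  qed
  have "((a \<otimes>\<^bsub>KG\<^esub> b) \<otimes>\<^bsub>KG\<^esub> c) x = (\<Oplus>\<^bsub>K\<^esub>y\<in>?F. (a \<otimes>\<^bsub>KG\<^esub> b) y \<otimes>\<^bsub>K\<^esub> c (inv\<^bsub>G\<^esub> y \<otimes>\<^bsub>G\<^esub> x))"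
    using a b c x F by (intro mult_apply supp_mult mult_closed_KG) auto
  also have "\<dots> = (\<Oplus>\<^bsub>K\<^esub>y\<in>?F. \<Oplus>\<^bsub>K\<^esub>z\<in>supp a. a z \<otimes>\<^bsub>K\<^esub> b (inv\<^bsub>G\<^esub> z \<otimes>\<^bsub>G\<^esub> y) \<otimes>\<^bsub>K\<^esub> c (inv\<^bsub>G\<^esub> y \<otimes>\<^bsub>G\<^esub> x))"
  proof (rule finsum_cong')
    fix y assume "y \<in> ?F"
    then have y: "y \<in> carrier G" using F by blast
    show "(a \<otimes>\<^bsub>KG\<^esub> b) y \<otimes>\<^bsub>K\<^esub> c (inv\<^bsub>G\<^esub> y \<otimes>\<^bsub>G\<^esub> x) = (\<Oplus>\<^bsub>K\<^esub>z\<in>supp a. a z \<otimes>\<^bsub>K\<^esub> b (inv\<^bsub>G\<^esub> z \<otimes>\<^bsub>G\<^esub> y) \<otimes>\<^bsub>K\<^esub> c (inv\<^bsub>G\<^esub> y \<otimes>\<^bsub>G\<^esub> x))"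
      unfolding mult_apply_supp[OF a b y]
      using a b c y x sa by (intro finsum_ldistr) auto
  qed (use a b c x F sa in \<open>auto intro!: finsum_closed simp: subset_iff\<close>)
  also have "\<dots> = (\<Oplus>\<^bsub>K\<^esub>z\<in>supp a. \<Oplus>\<^bsub>K\<^esub>y\<in>?F. a z \<otimes>\<^bsub>K\<^esub> b (inv\<^bsub>G\<^esub> z \<otimes>\<^bsub>G\<^esub> y) \<otimes>\<^bsub>K\<^esub> c (inv\<^bsub>G\<^esub> y \<otimes>\<^bsub>G\<^esub> x))"
    using a b c x F sa by (intro finsum_swap) (auto simp: subset_iff)
  also have "\<dots> = (\<Oplus>\<^bsub>K\<^esub>z\<in>supp a. a z \<otimes>\<^bsub>K\<^esub> (b \<otimes>\<^bsub>KG\<^esub> c) (inv\<^bsub>G\<^esub> z \<otimes>\<^bsub>G\<^esub> x))"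
  proof (rule finsum_cong')
    fix z assume z: "z \<in> supp a"
    then have zc: "z \<in> carrier G" using sa by blast
    have "(\<Oplus>\<^bsub>K\<^esub>y\<in>?F. a z \<otimes>\<^bsub>K\<^esub> b (inv\<^bsub>G\<^esub> z \<otimes>\<^bsub>G\<^esub> y) \<otimes>\<^bsub>K\<^esub> c (inv\<^bsub>G\<^esub> y \<otimes>\<^bsub>G\<^esub> x))
        = (\<Oplus>\<^bsub>K\<^esub>y\<in>?F. a z \<otimes>\<^bsub>K\<^esub> (b (inv\<^bsub>G\<^esub> z \<otimes>\<^bsub>G\<^esub> y) \<otimes>\<^bsub>K\<^esub> c (inv\<^bsub>G\<^esub> y \<otimes>\<^bsub>G\<^esub> x)))"
      using a b c x zc F by (intro finsum_cong' K.m_assoc) (auto simp: subset_iff)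
    also have "\<dots> = a z \<otimes>\<^bsub>K\<^esub> (b \<otimes>\<^bsub>KG\<^esub> c) (inv\<^bsub>G\<^esub> z \<otimes>\<^bsub>G\<^esub> x)"
      unfolding inner[OF z, symmetric]
      using a b c x zc F by (intro finsum_rdistr [symmetric]) (auto simp: subset_iff)
    finally show "(\<Oplus>\<^bsub>K\<^esub>y\<in>?F. a z \<otimes>\<^bsub>K\<^esub> b (inv\<^bsub>G\<^esub> z \<otimes>\<^bsub>G\<^esub> y) \<otimes>\<^bsub>K\<^esub> c (inv\<^bsub>G\<^esub> y \<otimes>\<^bsub>G\<^esub> x))
        = a z \<otimes>\<^bsub>K\<^esub> (b \<otimes>\<^bsub>KG\<^esub> c) (inv\<^bsub>G\<^esub> z \<otimes>\<^bsub>G\<^esub> x)" .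
  qed (use a b c x sa mult_closed_KG in auto)
  also have "\<dots> = (a \<otimes>\<^bsub>KG\<^esub> (b \<otimes>\<^bsub>KG\<^esub> c)) x"
    using a b c x by (simp add: mult_apply_supp mult_closed_KG)
  finally show "((a \<otimes>\<^bsub>KG\<^esub> b) \<otimes>\<^bsub>KG\<^esub> c) x = (a \<otimes>\<^bsub>KG\<^esub> (b \<otimes>\<^bsub>KG\<^esub> c)) x" .
qed (use a b c mult_closed_KG in auto)

section \<open>Translation by group elements and the ring laws\<close>

lemma ga_of_mult_apply:
  assumes "x \<in> carrier G" "a \<in> carrier KG" "y \<in> carrier G"
  shows "(ga_of K G x \<otimes>\<^bsub>KG\<^esub> a) y = a (inv\<^bsub>G\<^esub> x \<otimes>\<^bsub>G\<^esub> y)"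
proof -
  \<comment> \<open>The index set \<open>{x}\<close> also covers the zero ring, where the support of
    \<open>ga_of K G x\<close> is empty.\<close>
  have "(ga_of K G x \<otimes>\<^bsub>KG\<^esub> a) y = (\<Oplus>\<^bsub>K\<^esub>z\<in>{x}. ga_of K G x z \<otimes>\<^bsub>K\<^esub> a (inv\<^bsub>G\<^esub> z \<otimes>\<^bsub>G\<^esub> y))"
    using assms by (intro mult_apply) (auto simp: ga_support_def ga_term_apply split: if_splits)
  then show ?thesis
    using assms by (simp add: finsum_insert ga_term_apply)
qed

lemma mult_ga_of_apply:
  assumes "x \<in> carrier G" "a \<in> carrier KG" "y \<in> carrier G"
  shows "(a \<otimes>\<^bsub>KG\<^esub> ga_of K G x) y = a (y \<otimes>\<^bsub>G\<^esub> inv\<^bsub>G\<^esub> x)"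
proof -
  let ?w = "y \<otimes>\<^bsub>G\<^esub> inv\<^bsub>G\<^esub> x"
  have eq: "inv\<^bsub>G\<^esub> z \<otimes>\<^bsub>G\<^esub> y = x \<longleftrightarrow> z = ?w" if "z \<in> carrier G" for z
    using assms that by (metis G.inv_closed G.inv_solve_left G.inv_solve_right)
  \<comment> \<open>Only \<open>?w\<close> contributes; it is inserted into the index set because it
    may lie outside \<open>supp a\<close>.\<close>
  have "(a \<otimes>\<^bsub>KG\<^esub> ga_of K G x) y = (\<Oplus>\<^bsub>K\<^esub>z\<in>insert ?w (supp a). a z \<otimes>\<^bsub>K\<^esub> ga_of K G x (inv\<^bsub>G\<^esub> z \<otimes>\<^bsub>G\<^esub> y))"
    using assms supp_subset[of a] by (intro mult_apply) auto
  also have "\<dots> = (\<Oplus>\<^bsub>K\<^esub>z\<in>insert ?w (supp a). if ?w = z then a z else \<zero>\<^bsub>K\<^esub>)"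
    using assms supp_subset[of a]
    by (intro finsum_cong') (auto simp: ga_term_apply eq subset_iff)
  also have "\<dots> = a ?w"
    using assms supp_subset[of a] by (intro add.finprod_singleton) (auto simp: subset_iff)
  finally show ?thesis .
qed

lemma ring_group_algebra: "ring KG"
proof (rule ringI)
  show "abelian_group KG"
  proof (rule abelian_groupI)
    fix a assume a: "a \<in> carrier KG"
    let ?m = "\<lambda>x\<in>carrier G. \<ominus>\<^bsub>K\<^esub> a x"
    have "?m \<in> carrier KG"
      using a by (intro KG_memI[of "supp a"]) (auto simp: not_supp)
    then show "\<exists>b\<in>carrier KG. b \<oplus>\<^bsub>KG\<^esub> a = \<zero>\<^bsub>KG\<^esub>"
      using a by (intro bexI[of _ ?m] KG_eqI) (auto simp: add_closed_KG zero_closed_KG K.l_neg)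
  qed (auto intro!: KG_eqI simp: add_closed_KG zero_closed_KG K.a_ac)
  show "monoid KG"
  proof (rule monoidI)
    fix a assume a: "a \<in> carrier KG"
    show "\<one>\<^bsub>KG\<^esub> \<otimes>\<^bsub>KG\<^esub> a = a" "a \<otimes>\<^bsub>KG\<^esub> \<one>\<^bsub>KG\<^esub> = a"
      using a by (auto intro!: KG_eqI simp: one_KG mult_closed_KG ga_of_mult_apply mult_ga_of_apply)
  qed (simp_all add: mult_closed_KG one_closed_KG mult_assoc_KG)
next
  fix a b c assume a: "a \<in> carrier KG" and b: "b \<in> carrier KG" and c: "c \<in> carrier KG"
  have sa: "y \<in> carrier G" if "y \<in> supp a" for a y
    using that supp_subset by blast
  show "(a \<oplus>\<^bsub>KG\<^esub> b) \<otimes>\<^bsub>KG\<^esub> c = a \<otimes>\<^bsub>KG\<^esub> c \<oplus>\<^bsub>KG\<^esub> b \<otimes>\<^bsub>KG\<^esub> c"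
  proof (rule KG_eqI)
    fix x assume x: "x \<in> carrier G"
    let ?F = "supp a \<union> supp b"
    have F: "finite ?F" "?F \<subseteq> carrier G" using a b supp_subset by auto
    have sub: "supp (a \<oplus>\<^bsub>KG\<^esub> b) \<subseteq> ?F" by (auto simp: ga_support_def)
    have "((a \<oplus>\<^bsub>KG\<^esub> b) \<otimes>\<^bsub>KG\<^esub> c) x
        = (\<Oplus>\<^bsub>K\<^esub>y\<in>?F. a y \<otimes>\<^bsub>K\<^esub> c (inv\<^bsub>G\<^esub> y \<otimes>\<^bsub>G\<^esub> x) \<oplus>\<^bsub>K\<^esub> b y \<otimes>\<^bsub>K\<^esub> c (inv\<^bsub>G\<^esub> y \<otimes>\<^bsub>G\<^esub> x))"
      unfolding mult_apply[OF F(1) sub F(2) add_closed_KG[OF a b] c x]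
      using a b c x F by (intro finsum_cong') (auto simp: subset_iff K.l_distr)
    also have "\<dots> = (a \<otimes>\<^bsub>KG\<^esub> c) x \<oplus>\<^bsub>K\<^esub> (b \<otimes>\<^bsub>KG\<^esub> c) x"
      unfolding mult_apply[OF F(1) _ F(2) a c x, OF Un_upper1] mult_apply[OF F(1) _ F(2) b c x, OF Un_upper2]
      using a b c x F by (intro finsum_addf) (auto simp: subset_iff)
    finally show "((a \<oplus>\<^bsub>KG\<^esub> b) \<otimes>\<^bsub>KG\<^esub> c) x = (a \<otimes>\<^bsub>KG\<^esub> c \<oplus>\<^bsub>KG\<^esub> b \<otimes>\<^bsub>KG\<^esub> c) x"
      using x by simp
  qed (use a b c in \<open>auto simp: add_closed_KG mult_closed_KG\<close>)
  show "c \<otimes>\<^bsub>KG\<^esub> (a \<oplus>\<^bsub>KG\<^esub> b) = c \<otimes>\<^bsub>KG\<^esub> a \<oplus>\<^bsub>KG\<^esub> c \<otimes>\<^bsub>KG\<^esub> b"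
  proof (rule KG_eqI)
    fix x assume x: "x \<in> carrier G"
    have "(c \<otimes>\<^bsub>KG\<^esub> (a \<oplus>\<^bsub>KG\<^esub> b)) x
        = (\<Oplus>\<^bsub>K\<^esub>y\<in>supp c. c y \<otimes>\<^bsub>K\<^esub> a (inv\<^bsub>G\<^esub> y \<otimes>\<^bsub>G\<^esub> x) \<oplus>\<^bsub>K\<^esub> c y \<otimes>\<^bsub>K\<^esub> b (inv\<^bsub>G\<^esub> y \<otimes>\<^bsub>G\<^esub> x))"
      unfolding mult_apply_supp[OF c add_closed_KG[OF a b] x]
      using a b c x sa by (intro finsum_cong') (auto simp: K.r_distr)
    also have "\<dots> = (c \<otimes>\<^bsub>KG\<^esub> a) x \<oplus>\<^bsub>K\<^esub> (c \<otimes>\<^bsub>KG\<^esub> b) x"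
      unfolding mult_apply_supp[OF c a x] mult_apply_supp[OF c b x]
      using a b c x sa by (intro finsum_addf) auto
    finally show "(c \<otimes>\<^bsub>KG\<^esub> (a \<oplus>\<^bsub>KG\<^esub> b)) x = (c \<otimes>\<^bsub>KG\<^esub> a \<oplus>\<^bsub>KG\<^esub> c \<otimes>\<^bsub>KG\<^esub> b) x"
      using x by simp
  qed (use a b c in \<open>auto simp: add_closed_KG mult_closed_KG\<close>)
qed

end

subsection \<open>Unitary units\<close>

context group_ring
begin

sublocale KG: ring KG
  by (rule ring_group_algebra)

text \<open>For finite \<open>A\<close> inside the group this is the sum of the elements of
  \<open>A\<close> in the group algebra. Left multiplication by a group element then becomes
  translation of sets.\<close>

definition ind :: "'c set \<Rightarrow> 'c \<Rightarrow> 'a" where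
  "ind A = (\<lambda>x\<in>carrier G. if x \<in> A then \<one>\<^bsub>K\<^esub> else \<zero>\<^bsub>K\<^esub>)"

lemma ind_apply: "x \<in> carrier G \<Longrightarrow> ind A x = (if x \<in> A then \<one>\<^bsub>K\<^esub> else \<zero>\<^bsub>K\<^esub>)"
  by (simp add: ind_def)

lemma ind_closed: "finite A \<Longrightarrow> ind A \<in> carrier KG"
  unfolding ind_def by (rule KG_memI[of A]) auto

text \<open>Negation in the group algebra is only given as an additive inverse, so its coefficients
  are found from the uniqueness of additive inverses in \<open>K\<close>.\<close>

lemma uminus_apply [simp]:
  assumes "a \<in> carrier KG" "x \<in> carrier G"
  shows "(\<ominus>\<^bsub>KG\<^esub> a) x = \<ominus>\<^bsub>K\<^esub> a x"
proof -
  have "(\<ominus>\<^bsub>KG\<^esub> a) x \<oplus>\<^bsub>K\<^esub> a x = (\<ominus>\<^bsub>KG\<^esub> a \<oplus>\<^bsub>KG\<^esub> a) x"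
    using assms by simp
  also have "\<dots> = \<zero>\<^bsub>K\<^esub>"
    using assms by (simp only: KG.l_neg zero_apply)
  finally show ?thesis
    using assms K.minus_equality by (metis KG_apply_closed KG.a_inv_closed)
qed

lemma minus_apply [simp]:
  assumes "a \<in> carrier KG" "b \<in> carrier KG" "x \<in> carrier G"
  shows "(a \<ominus>\<^bsub>KG\<^esub> b) x = a x \<ominus>\<^bsub>K\<^esub> b x"
  using assms by (simp add: a_minus_def)

lemma finsum_KG_apply:
  assumes "finite I" "\<And>i. i \<in> I \<Longrightarrow> f i \<in> carrier KG" "x \<in> carrier G"
  shows "(\<Oplus>\<^bsub>KG\<^esub>i\<in>I. f i) x = (\<Oplus>\<^bsub>K\<^esub>i\<in>I. f i x)"
  using assms(1,2)
proof (induction I rule: finite_induct)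
  case empty
  then show ?case using assms(3) by (simp add: KG.finsum_empty K.finsum_empty)
next
  case (insert i I)
  then have "(\<Oplus>\<^bsub>KG\<^esub>i\<in>insert i I. f i) = f i \<oplus>\<^bsub>KG\<^esub> (\<Oplus>\<^bsub>KG\<^esub>i\<in>I. f i)"
    by (intro KG.finsum_insert) auto
  moreover have "(\<Oplus>\<^bsub>K\<^esub>i\<in>insert i I. f i x) = f i x \<oplus>\<^bsub>K\<^esub> (\<Oplus>\<^bsub>K\<^esub>i\<in>I. f i x)"
    using insert assms(3) by (intro K.finsum_insert) auto
  ultimately show ?case
    using insert assms(3) by simp
qed

text \<open>The powers of \<open>g\<close> with exponent below the order are distinct and exhaust
  the subgroup, so exactly one summand contributes at each of its elements.\<close>

lemma ga_bar_eq_ind: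
  assumes g: "g \<in> carrier G" and ord: "G.ord g \<noteq> 0"
  shows "ga_bar K G g = ind (generate G {g})"
proof (rule KG_eqI)
  show "ga_bar K G g \<in> carrier KG"
    unfolding ga_bar_def by (intro KG.finsum_closed) auto
  show "ind (generate G {g}) \<in> carrier KG"
    using G.finite_generate_singleton[OF g ord] by (rule ind_closed)
  fix x assume x: "x \<in> carrier G"
  have gen: "generate G {g} = {g [^]\<^bsub>G\<^esub> i | i::nat. i \<in> {..<G.ord g}}"
  proof -
    \<comment> \<open>With truncated subtraction the two ranges differ at order 0, where the left
      one is \<open>{0}\<close>.\<close>
    have "{0..G.ord g - 1} = {..<G.ord g}" using ord by auto
    then show ?thesis
      using G.generate_pow_nat[OF g ord] G.ord_elems_inf_carrier[OF g ord] by simp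
  qed
  have inj: "inj_on (\<lambda>i::nat. g [^]\<^bsub>G\<^esub> i) {..<G.ord g}"
    using G.ord_inj[OF g] by (rule inj_on_subset) auto
  have eq: "ga_bar K G g x = (\<Oplus>\<^bsub>K\<^esub>i\<in>{..<G.ord g}. if x = g [^]\<^bsub>G\<^esub> i then \<one>\<^bsub>K\<^esub> else \<zero>\<^bsub>K\<^esub>)"
    unfolding ga_bar_def using x by (simp add: finsum_KG_apply ga_term_apply)
  show "ga_bar K G g x = ind (generate G {g}) x"
  proof (cases "x \<in> generate G {g}")
    case True
    then obtain j where j: "j < G.ord g" "x = g [^]\<^bsub>G\<^esub> j" unfolding gen by blast
    have "ga_bar K G g x = (\<Oplus>\<^bsub>K\<^esub>i\<in>{..<G.ord g}. if j = i then \<one>\<^bsub>K\<^esub> else \<zero>\<^bsub>K\<^esub>)"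
      unfolding eq using j inj by (intro K.finsum_cong') (auto dest: inj_onD)
    also have "\<dots> = \<one>\<^bsub>K\<^esub>"
      using j by (intro K.add.finprod_singleton) auto
    finally show ?thesis using True x by (simp add: ind_apply)
  next
    case False
    then have "ga_bar K G g x = \<zero>\<^bsub>K\<^esub>"
      unfolding eq gen by (intro K.add.finprod_one_eqI) auto
    then show ?thesis using False x by (simp add: ind_apply)
  qed
qed

section \<open>Involution and augmentation\<close>

lemma ga_star_closed: "a \<in> carrier KG \<Longrightarrow> ga_star K G a \<in> carrier KG"
  unfolding ga_star_def using supp_subset[of a]
  by (intro KG.finsum_closed) (auto simp: subset_iff)

text \<open>Inversion is a bijection, so only the summand of \<open>inv y\<close> can contribute at
  \<open>y\<close>.\<close>

lemma ga_star_apply: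
  assumes a: "a \<in> carrier KG" and y: "y \<in> carrier G"
  shows "ga_star K G a y = a (inv\<^bsub>G\<^esub> y)"
proof -
  have sa: "x \<in> carrier G" if "x \<in> supp a" for x
    using that supp_subset by blast
  have "ga_star K G a y = (\<Oplus>\<^bsub>K\<^esub>x\<in>supp a. ga_term K G (a x) (inv\<^bsub>G\<^esub> x) y)"
    unfolding ga_star_def using a y sa by (intro finsum_KG_apply) auto
  also have "\<dots> = (\<Oplus>\<^bsub>K\<^esub>x\<in>supp a. if inv\<^bsub>G\<^esub> y = x then a x else \<zero>\<^bsub>K\<^esub>)"
    using a y sa by (intro K.finsum_cong') (auto simp: ga_term_apply)
  also have "\<dots> = a (inv\<^bsub>G\<^esub> y)"
  proof (cases "inv\<^bsub>G\<^esub> y \<in> supp a")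
    case True
    then show ?thesis using a sa by (intro K.add.finprod_singleton) auto
  next
    case False
    then have "(\<Oplus>\<^bsub>K\<^esub>x\<in>supp a. if inv\<^bsub>G\<^esub> y = x then a x else \<zero>\<^bsub>K\<^esub>) = \<zero>\<^bsub>K\<^esub>"
      by (intro K.add.finprod_one_eqI) auto
    then show ?thesis using False y by (simp add: not_supp)
  qed
  finally show ?thesis .
qed

lemma augmentation_eq:
  assumes "finite F" "supp a \<subseteq> F" "F \<subseteq> carrier G" "a \<in> carrier KG"
  shows "augmentation K G a = (\<Oplus>\<^bsub>K\<^esub>x\<in>F. a x)"
  unfolding augmentation_def
  by (rule K.add.finprod_mono_neutral_cong_left) (use assms in \<open>auto simp: not_supp subset_iff\<close>)

lemma augmentation_closed: "a \<in> carrier KG \<Longrightarrow> augmentation K G a \<in> carrier K"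
  unfolding augmentation_def using supp_subset[of a]
  by (intro K.finsum_closed) (auto simp: subset_iff)

lemma augmentation_add:
  assumes a: "a \<in> carrier KG" and b: "b \<in> carrier KG"
  shows "augmentation K G (a \<oplus>\<^bsub>KG\<^esub> b) = augmentation K G a \<oplus>\<^bsub>K\<^esub> augmentation K G b"
proof -
  let ?F = "supp a \<union> supp b"
  have F: "finite ?F" "?F \<subseteq> carrier G" using a b supp_subset by auto
  have sub: "supp (a \<oplus>\<^bsub>KG\<^esub> b) \<subseteq> ?F" by (auto simp: ga_support_def)
  have "augmentation K G (a \<oplus>\<^bsub>KG\<^esub> b) = (\<Oplus>\<^bsub>K\<^esub>x\<in>?F. a x \<oplus>\<^bsub>K\<^esub> b x)"
    unfolding augmentation_eq[OF F(1) sub F(2) KG.a_closed[OF a b]]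
    using a b F by (intro K.finsum_cong') (auto simp: subset_iff)
  also have "\<dots> = augmentation K G a \<oplus>\<^bsub>K\<^esub> augmentation K G b"
    unfolding augmentation_eq[OF F(1) Un_upper1 F(2) a] augmentation_eq[OF F(1) Un_upper2 F(2) b]
    using a b F by (intro K.finsum_addf) (auto simp: subset_iff)
  finally show ?thesis .
qed

text \<open>Left translation by \<open>x\<close> only permutes the coefficients. It serves to show
  that a difference of two translates has augmentation zero.\<close>

lemma augmentation_ga_of_mult:
  assumes x: "x \<in> carrier G" and a: "a \<in> carrier KG"
  shows "augmentation K G (ga_of K G x \<otimes>\<^bsub>KG\<^esub> a) = augmentation K G a"
proof -
  let ?F = "(\<otimes>\<^bsub>G\<^esub>) x ` supp a"
  have sa: "y \<in> carrier G" if "y \<in> supp a" for y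
    using that supp_subset by blast
  have "supp (ga_of K G x \<otimes>\<^bsub>KG\<^esub> a) \<subseteq> ?F"
  proof
    fix y assume "y \<in> supp (ga_of K G x \<otimes>\<^bsub>KG\<^esub> a)"
    then have y: "y \<in> carrier G" "inv\<^bsub>G\<^esub> x \<otimes>\<^bsub>G\<^esub> y \<in> supp a"
      using x a by (auto simp: ga_support_def ga_of_mult_apply)
    moreover have "y = x \<otimes>\<^bsub>G\<^esub> (inv\<^bsub>G\<^esub> x \<otimes>\<^bsub>G\<^esub> y)" using x y by simp
    ultimately show "y \<in> ?F" by blast
  qed
  then have "augmentation K G (ga_of K G x \<otimes>\<^bsub>KG\<^esub> a) = (\<Oplus>\<^bsub>K\<^esub>y\<in>?F. (ga_of K G x \<otimes>\<^bsub>KG\<^esub> a) y)"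
    using x a sa by (intro augmentation_eq) auto
  also have "\<dots> = (\<Oplus>\<^bsub>K\<^esub>y\<in>supp a. (ga_of K G x \<otimes>\<^bsub>KG\<^esub> a) (x \<otimes>\<^bsub>G\<^esub> y))"
    using x a sa by (intro K.add.finprod_reindex) (auto simp: inj_on_def)
  also have "\<dots> = augmentation K G a"
    unfolding augmentation_def
    using x a sa by (intro K.finsum_cong') (auto simp: ga_of_mult_apply)
  finally show ?thesis .
qed

lemma augmentation_one: "augmentation K G \<one>\<^bsub>KG\<^esub> = \<one>\<^bsub>K\<^esub>"
proof -
  have "augmentation K G \<one>\<^bsub>KG\<^esub> = (\<Oplus>\<^bsub>K\<^esub>x\<in>{\<one>\<^bsub>G\<^esub>}. \<one>\<^bsub>KG\<^esub> x)"
    by (intro augmentation_eq) (auto simp: ga_support_def one_KG ga_term_apply split: if_splits)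
  then show ?thesis by (simp add: K.finsum_insert one_KG ga_term_apply)
qed

text \<open>As \<open>t\<close> squares to zero, \<open>1 - t\<close> is the inverse of
  \<open>1 + t\<close>. The involution fixes 1, so unitarity reduces to a comparison of the
  coefficients of the image of \<open>t\<close> with those of \<open>- t\<close>.\<close>

lemma unitary_one_add_square_zero_iff:
  assumes t: "t \<in> carrier KG" and sq: "t \<otimes>\<^bsub>KG\<^esub> t = \<zero>\<^bsub>KG\<^esub>"
    and aug: "augmentation K G t = \<zero>\<^bsub>K\<^esub>"
  shows "unitary K G (\<one>\<^bsub>KG\<^esub> \<oplus>\<^bsub>KG\<^esub> t) \<longleftrightarrow> (\<forall>y\<in>carrier G. t (inv\<^bsub>G\<^esub> y) = \<ominus>\<^bsub>K\<^esub> t y)"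
proof -
  let ?u = "\<one>\<^bsub>KG\<^esub> \<oplus>\<^bsub>KG\<^esub> t" and ?v = "\<one>\<^bsub>KG\<^esub> \<oplus>\<^bsub>KG\<^esub> (\<ominus>\<^bsub>KG\<^esub> t)"
  have c: "?u \<in> carrier KG" "?v \<in> carrier KG" using t by auto
  have uv: "?u \<otimes>\<^bsub>KG\<^esub> ?v = \<one>\<^bsub>KG\<^esub>" "?v \<otimes>\<^bsub>KG\<^esub> ?u = \<one>\<^bsub>KG\<^esub>"
    using t sq by (simp_all add: KG.l_distr KG.r_distr KG.l_minus KG.r_minus KG.a_assoc KG.l_neg KG.r_neg KG.r_neg1 KG.r_neg2)
  have "?u \<in> Units KG" using c uv unfolding Units_def by blast
  moreover have "inv\<^bsub>KG\<^esub> ?u = ?v"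
    using c uv by (intro KG.inv_char) auto
  moreover have "augmentation K G ?u = \<one>\<^bsub>K\<^esub>"
    using t by (simp add: augmentation_add augmentation_one aug)
  ultimately have "unitary K G ?u \<longleftrightarrow> ga_star K G ?u = ?v"
    unfolding unitary_def by simp
  also have "\<dots> \<longleftrightarrow> (\<forall>y\<in>carrier G. ?u (inv\<^bsub>G\<^esub> y) = ?v y)"
    using c ga_star_closed[OF c(1)] by (metis KG_eqI ga_star_apply)
  also have "\<dots> \<longleftrightarrow> (\<forall>y\<in>carrier G. t (inv\<^bsub>G\<^esub> y) = \<ominus>\<^bsub>K\<^esub> t y)"
  proof (rule ball_cong)
    fix y assume y: "y \<in> carrier G"
    have "\<one>\<^bsub>KG\<^esub> (inv\<^bsub>G\<^esub> y) = \<one>\<^bsub>KG\<^esub> y"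
      using y by (simp add: one_KG ga_term_apply G.inv_eq_1_iff)
    then show "?u (inv\<^bsub>G\<^esub> y) = ?v y \<longleftrightarrow> t (inv\<^bsub>G\<^esub> y) = \<ominus>\<^bsub>K\<^esub> t y"
      using t y by simp
  qed simp
  finally show ?thesis .
qed

text \<open>Multiplying out shows that \<open>t\<close> is \<open>(g - 1) h (bar g)\<close>. Its
  square contains the factor \<open>(bar g) (g - 1)\<close>, which vanishes because right
  multiplication by \<open>g\<close> permutes \<open>S\<close>.\<close>

lemma unitary_bicyclic_iff:
  assumes g: "g \<in> carrier G" and ord: "G.ord g \<noteq> 0" and h: "h \<in> carrier G"
  defines "S \<equiv> generate G {g}"
  defines "t \<equiv> ind ((g \<otimes>\<^bsub>G\<^esub> h) <#\<^bsub>G\<^esub> S) \<ominus>\<^bsub>KG\<^esub> ind (h <#\<^bsub>G\<^esub> S)"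
  shows "unitary K G (bicyclic_unit K G g h) \<longleftrightarrow> (\<forall>y\<in>carrier G. t (inv\<^bsub>G\<^esub> y) = \<ominus>\<^bsub>K\<^esub> t y)"
proof -
  let ?g = "ga_of K G g" and ?h = "ga_of K G h" and ?bar = "ind S"
  have S: "subgroup S G" unfolding S_def using g by (intro G.generate_is_subgroup) auto
  have finS: "finite S" unfolding S_def by (rule G.finite_generate_singleton[OF g ord])
  have fin: "finite (x <#\<^bsub>G\<^esub> S)" for x unfolding l_coset_def using finS by simp
  have c [simp]: "?g \<in> carrier KG" "?h \<in> carrier KG" "?bar \<in> carrier KG" by (auto intro: ind_closed finS)
  have gS: "g \<in> S" unfolding S_def by (simp add: generate.incl)
  have coset: "ga_of K G x \<otimes>\<^bsub>KG\<^esub> ind S = ind (x <#\<^bsub>G\<^esub> S)" if x: "x \<in> carrier G" for x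
    using x by (intro KG_eqI) (auto simp: ga_of_mult_apply ind_closed fin ind_apply G.mem_l_coset_iff[OF S])
  have gcoset: "?g \<otimes>\<^bsub>KG\<^esub> ind (h <#\<^bsub>G\<^esub> S) = ind ((g \<otimes>\<^bsub>G\<^esub> h) <#\<^bsub>G\<^esub> S)"
    using g h by (intro KG_eqI)
      (auto simp: ga_of_mult_apply ind_closed fin ind_apply G.mem_l_coset_iff[OF S] G.inv_mult_group G.m_assoc)
  have barg: "?bar \<otimes>\<^bsub>KG\<^esub> ?g = ?bar"
  proof (rule KG_eqI)
    fix y assume y: "y \<in> carrier G"
    have "y \<otimes>\<^bsub>G\<^esub> inv\<^bsub>G\<^esub> g \<in> S \<longleftrightarrow> y \<in> S"
    proof
      assume "y \<otimes>\<^bsub>G\<^esub> inv\<^bsub>G\<^esub> g \<in> S"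
      from subgroup.m_closed[OF S this gS] show "y \<in> S" using g y by (simp add: G.m_assoc)
    qed (use subgroup.m_closed[OF S] subgroup.m_inv_closed[OF S gS] in blast)
    then show "(?bar \<otimes>\<^bsub>KG\<^esub> ?g) y = ?bar y"
      using g y by (simp add: mult_ga_of_apply ind_apply)
  qed auto
  have t: "t = (?g \<ominus>\<^bsub>KG\<^esub> \<one>\<^bsub>KG\<^esub>) \<otimes>\<^bsub>KG\<^esub> ?h \<otimes>\<^bsub>KG\<^esub> ?bar"
    unfolding t_def a_minus_def
    by (simp add: KG.m_assoc KG.l_distr KG.l_minus coset gcoset h ind_closed fin)
  have tc: "t \<in> carrier KG" unfolding t by simp
  have "?bar \<otimes>\<^bsub>KG\<^esub> (?g \<ominus>\<^bsub>KG\<^esub> \<one>\<^bsub>KG\<^esub>) = \<zero>\<^bsub>KG\<^esub>"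
    unfolding a_minus_def by (simp add: KG.r_distr KG.r_minus barg KG.r_neg)
  moreover have "t \<otimes>\<^bsub>KG\<^esub> t = (?g \<ominus>\<^bsub>KG\<^esub> \<one>\<^bsub>KG\<^esub>) \<otimes>\<^bsub>KG\<^esub> ?h \<otimes>\<^bsub>KG\<^esub> (?bar \<otimes>\<^bsub>KG\<^esub> (?g \<ominus>\<^bsub>KG\<^esub> \<one>\<^bsub>KG\<^esub>)) \<otimes>\<^bsub>KG\<^esub> (?h \<otimes>\<^bsub>KG\<^esub> ?bar)"
    unfolding t by (simp add: KG.m_assoc)
  ultimately have sq: "t \<otimes>\<^bsub>KG\<^esub> t = \<zero>\<^bsub>KG\<^esub>" by simp
  let ?W = "ind (h <#\<^bsub>G\<^esub> S)"
  have W: "?W \<in> carrier KG" by (rule ind_closed[OF fin])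
  \<comment> \<open>Since \<open>g ?W\<close> and \<open>?W\<close> have the same augmentation, that
    of their difference \<open>t\<close> is zero.\<close>
  have "t \<oplus>\<^bsub>KG\<^esub> ?W = ?g \<otimes>\<^bsub>KG\<^esub> ?W"
    unfolding t_def a_minus_def gcoset by (simp add: KG.a_assoc KG.l_neg ind_closed fin)
  then have "augmentation K G t \<oplus>\<^bsub>K\<^esub> augmentation K G ?W = augmentation K G ?W"
    using augmentation_add[OF tc W] augmentation_ga_of_mult[OF g W] by simp
  then have "augmentation K G t = \<zero>\<^bsub>K\<^esub>"
    using augmentation_closed[OF tc] augmentation_closed[OF W] by (metis K.add.r_cancel_one')
  moreover have "bicyclic_unit K G g h = \<one>\<^bsub>KG\<^esub> \<oplus>\<^bsub>KG\<^esub> t"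
    unfolding bicyclic_unit_def ga_bar_eq_ind[OF g ord] t S_def ..
  ultimately show ?thesis
    using unitary_one_add_square_zero_iff[OF tc sq] by simp
qed

end

text \<open>\<open>1 + 1 = 0\<close> means that the additive order of 1 divides the prime 2, and
  order 1 is excluded by \<open>1\<close> being nonzero.\<close>

lemma (in ring) ring_characteristic_eq_2_iff:
  assumes "\<one> \<noteq> \<zero>"
  shows "ring_characteristic R = 2 \<longleftrightarrow> \<one> \<oplus> \<one> = \<zero>"
proof -
  have "\<one> \<oplus> \<one> = \<zero> \<longleftrightarrow> add.ord \<one> dvd 2"
    using add.pow_eq_id[of \<one> 2] by (simp add: numeral_2_eq_2)
  also have "\<dots> \<longleftrightarrow> add.ord \<one> = 2"
    using assms add.ord_eq_1[of \<one>] two_is_prime_nat by (auto simp: prime_nat_iff)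
  finally show ?thesis by (simp add: ring_characteristic_def)
qed

theorem lemma1p3:
  fixes K :: "('k, 'm) ring_scheme" and G :: "('g, 'n) monoid_scheme" and g h :: 'g
  assumes "cring K" and "\<one>\<^bsub>K\<^esub> \<noteq> \<zero>\<^bsub>K\<^esub>"
    and "group G"
    and "g \<in> carrier G" and "\<exists>n::nat. n > 0 \<and> g [^]\<^bsub>G\<^esub> n = \<one>\<^bsub>G\<^esub>"
    and "h \<in> carrier G" and "\<not> normalizes G h (generate G {g})"
  shows "unitary K G (bicyclic_unit K G g h) \<longleftrightarrow>
    ring_characteristic K = 2 \<and>
    normalizes G h (generate G {g [^]\<^bsub>G\<^esub> (2::nat)}) \<and>
    (h [^]\<^bsub>G\<^esub> (2::nat) \<in> generate G {g [^]\<^bsub>G\<^esub> (2::nat)} \<or>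
     (h \<otimes>\<^bsub>G\<^esub> g) [^]\<^bsub>G\<^esub> (2::nat) \<in> generate G {g [^]\<^bsub>G\<^esub> (2::nat)})"
proof -
  interpret K: cring K by fact
  interpret G: group G by fact
  interpret group_ring K G ..
  note g = assms(4) and h = assms(6) and nz = assms(2)
  have ord: "G.ord g \<noteq> 0"
    using assms(5) G.pow_eq_id[OF g] by auto
  define S where "S = generate G {g}"
  let ?A = "h <#\<^bsub>G\<^esub> S" and ?B = "(g \<otimes>\<^bsub>G\<^esub> h) <#\<^bsub>G\<^esub> S"
  let ?i = "\<lambda>y. inv\<^bsub>G\<^esub> y" and ?t = "ind ?B \<ominus>\<^bsub>KG\<^esub> ind ?A"
  have S: "subgroup S G" unfolding S_def using g by (intro G.generate_is_subgroup) auto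
  have gS: "g \<in> S" unfolding S_def by (simp add: generate.incl)
  note [simp] = subgroup.mem_carrier[OF S]
  have ncg: "inv\<^bsub>G\<^esub> h \<otimes>\<^bsub>G\<^esub> (g \<otimes>\<^bsub>G\<^esub> h) \<notin> S"
    using assms(7) G.normalizes_generate_iff[OF g ord h] g h unfolding S_def by (simp add: G.m_assoc)
  have fin: "finite (x <#\<^bsub>G\<^esub> S)" for x
    unfolding l_coset_def S_def using G.finite_generate_singleton[OF g ord] by simp
  have A: "y \<in> ?A \<longleftrightarrow> inv\<^bsub>G\<^esub> h \<otimes>\<^bsub>G\<^esub> y \<in> S"
    and B: "y \<in> ?B \<longleftrightarrow> inv\<^bsub>G\<^esub> h \<otimes>\<^bsub>G\<^esub> (inv\<^bsub>G\<^esub> g \<otimes>\<^bsub>G\<^esub> y) \<in> S" if "y \<in> carrier G" for y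
    using G.mem_l_coset_iff[OF S _ that] g h that by (simp_all add: G.inv_mult_group G.m_assoc)
  have AB: "?A \<union> ?B \<subseteq> carrier G"
    using g h by (auto simp: l_coset_def)
  \<comment> \<open>The quotient of \<open>h^-1 y\<close> by \<open>h^-1 g^-1 y\<close> is
    \<open>h^-1 g h\<close>, which is not in \<open>S\<close>.\<close>
  have disj: "\<not> (y \<in> ?A \<and> y \<in> ?B)" if y: "y \<in> carrier G" for y
  proof
    assume yy: "y \<in> ?A \<and> y \<in> ?B"
    then have "(inv\<^bsub>G\<^esub> h \<otimes>\<^bsub>G\<^esub> y) \<otimes>\<^bsub>G\<^esub> inv\<^bsub>G\<^esub> (inv\<^bsub>G\<^esub> h \<otimes>\<^bsub>G\<^esub> (inv\<^bsub>G\<^esub> g \<otimes>\<^bsub>G\<^esub> y)) \<in> S"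
      using A[OF y] B[OF y] subgroup.m_closed[OF S] subgroup.m_inv_closed[OF S] by blast
    then show False
      using ncg g h y by (simp add: G.inv_mult_group G.m_assoc)
  qed
  \<comment> \<open>This excludes characteristic other than 2, where the star would have to exchange the two
    cosets.\<close>
  have not_swapped: "\<exists>y\<in>?A. ?i y \<notin> ?B"
  proof (rule ccontr)
    assume "\<not> ?thesis"
    then have sub: "?i y \<in> ?B" if "y \<in> ?A" for y using that by blast
    \<comment> \<open>The elements \<open>h\<close> and \<open>h g\<close> of \<open>?A\<close>
      suffice: if both inverses were in \<open>?B\<close>, then \<open>h^-1 g^-1 h^-1\<close> and
      \<open>h^-1 g^-2 h^-1\<close> would be in \<open>S\<close>, and so would their quotient
      \<open>h^-1 g h\<close>.\<close>
    have "h \<otimes>\<^bsub>G\<^esub> \<one>\<^bsub>G\<^esub> \<in> ?A" "h \<otimes>\<^bsub>G\<^esub> g \<in> ?A"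
      unfolding l_coset_def using gS subgroup.one_closed[OF S] by blast+
    from this[THEN sub] have "inv\<^bsub>G\<^esub> h \<otimes>\<^bsub>G\<^esub> (inv\<^bsub>G\<^esub> g \<otimes>\<^bsub>G\<^esub> inv\<^bsub>G\<^esub> h) \<in> S"
      "inv\<^bsub>G\<^esub> h \<otimes>\<^bsub>G\<^esub> (inv\<^bsub>G\<^esub> g \<otimes>\<^bsub>G\<^esub> (inv\<^bsub>G\<^esub> g \<otimes>\<^bsub>G\<^esub> inv\<^bsub>G\<^esub> h)) \<in> S"
      using g h by (simp_all add: B G.inv_mult_group)
    from subgroup.m_closed[OF S this(1) subgroup.m_inv_closed[OF S this(2)]] show False
      using ncg g h by (simp add: G.inv_mult_group G.m_assoc)
  qed
  have ty: "?t y = (if y \<in> ?B then \<one>\<^bsub>K\<^esub> else if y \<in> ?A then \<ominus>\<^bsub>K\<^esub> \<one>\<^bsub>K\<^esub> else \<zero>\<^bsub>K\<^esub>)"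
    if "y \<in> carrier G" for y
    using that disj[OF that] by (auto simp: ind_closed fin ind_apply a_minus_def)
  have neg: "\<ominus>\<^bsub>K\<^esub> \<one>\<^bsub>K\<^esub> = \<one>\<^bsub>K\<^esub> \<longleftrightarrow> \<one>\<^bsub>K\<^esub> \<oplus>\<^bsub>K\<^esub> \<one>\<^bsub>K\<^esub> = \<zero>\<^bsub>K\<^esub>"
    using K.minus_equality K.l_neg by (metis K.one_closed)
  have nnz: "\<ominus>\<^bsub>K\<^esub> \<one>\<^bsub>K\<^esub> \<noteq> \<zero>\<^bsub>K\<^esub>"
    using nz by (metis K.minus_minus K.minus_zero K.one_closed)
  have "(\<forall>y\<in>carrier G. ?t (?i y) = \<ominus>\<^bsub>K\<^esub> ?t y) \<longleftrightarrow>
      \<one>\<^bsub>K\<^esub> \<oplus>\<^bsub>K\<^esub> \<one>\<^bsub>K\<^esub> = \<zero>\<^bsub>K\<^esub> \<and> (\<forall>y\<in>?A \<union> ?B. ?i y \<in> ?A \<union> ?B)" (is "?L \<longleftrightarrow> ?R")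
  proof
    assume L: ?L
    \<comment> \<open>Both 1 and -1 are nonzero, so \<open>?A \<union> ?B\<close> is exactly where
      \<open>?t\<close> does not vanish, and this set is preserved when inversion merely changes
      signs.\<close>
    have sym: "?i y \<in> ?A \<union> ?B" if "y \<in> ?A \<union> ?B" for y
    proof -
      have y: "y \<in> carrier G" using that AB by blast
      then show ?thesis
        using L[rule_format, OF y] that nz nz[symmetric] nnz nnz[symmetric] by (auto simp: ty split: if_splits)
    qed
    \<comment> \<open>Such a \<open>y\<close> and its inverse both lie in \<open>?A\<close>, where
      the coefficient is -1; the condition on signs then reads \<open>-1 = 1\<close>.\<close>
    obtain y where y: "y \<in> ?A" "?i y \<notin> ?B" using not_swapped by blast
    then have yc: "y \<in> carrier G" and "?i y \<in> ?A" "y \<notin> ?B" using AB sym disj by blast+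
    then have "\<ominus>\<^bsub>K\<^esub> \<one>\<^bsub>K\<^esub> = \<one>\<^bsub>K\<^esub>"
      using L[rule_format, OF yc] y by (simp add: ty)
    then show ?R using neg sym by blast
  next
    assume R: ?R
    \<comment> \<open>With \<open>-1 = 1\<close> the signs disappear and \<open>?t\<close> is the
      indicator function of \<open>?A \<union> ?B\<close>, so only closure under inversion
      matters.\<close>
    then have m: "\<ominus>\<^bsub>K\<^esub> \<one>\<^bsub>K\<^esub> = \<one>\<^bsub>K\<^esub>" using neg by blast
    show ?L
    proof
      fix y assume y: "y \<in> carrier G"
      \<comment> \<open>Inversion is an involution, so closure gives both directions.\<close>
      have "?i y \<in> ?A \<union> ?B \<longleftrightarrow> y \<in> ?A \<union> ?B"
        using R y by (metis G.inv_inv)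
      then show "?t (?i y) = \<ominus>\<^bsub>K\<^esub> ?t y"
        using y by (auto simp: ty m)
    qed
  qed
  then show ?thesis
    using unitary_bicyclic_iff[OF g ord h] K.ring_characteristic_eq_2_iff[OF nz]
      G.symmetric_double_coset_iff[OF g ord h assms(7)]
    unfolding S_def by simp
qed

end
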